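(* Let $n\ge 1$, let $x^\ast\in\mathbb{R}^n$, and let $\mathcal{D}$ be a probability distribution on $\mathbb{R}^n$ with $\varphi\neq 0$ almost surely for $\varphi\sim\mathcal{D}$. Let $\{\varphi_t\}_{t=1}^\infty$ be sampled independently from $\mathcal{D}$, and let $y_t=\langle\varphi_t,x^\ast\rangle$ for all $t\ge 1$. Put $$W=\mathbb{E}_{\varphi\sim\mathcal{D}}\left[\frac{\varphi\varphi^\top}{\|\varphi\|^2}\right],$$ and let $\sigma_{\min}(W)$ and $\sigma_{\max}(W)$ be its smallest and largest singular values. Let $\beta\in(0,1)$ satisfy $$4\beta+4\beta^2-(1+\beta)\,\sigma_{\min}(W)+\beta\,\sigma_{\max}(W)<0 .$$ Let $x_0\in\mathbb{R}^n$ be an arbitrary (deterministic) initial iterate, and let $(x_t)_{t\ge 0}$ be the iterates produced by OHBK($\beta$) from $x_0$ and the measurements $\{(\varphi_t,y_t)\}_{t=1}^\infty$, i.e. $x_1=x_0$ and, for $t\ge 1$, $$x_{t+1}=x_t-\frac{\langle\varphi_t,x_t\rangle-y_t}{\|\varphi_t\|^2}\,\varphi_t+\beta\,(x_t-x_{t-1}).$$ Then there exist $\delta>0$ and $q\in(0,1)$ such that for all $t\ge 0$, $$\mathbb{E}\left[\|x_t-x^\ast\|^2\right]\le q^t(1+\delta)\,\|x_0-x^\ast\|^2 .$$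
   Context: $\|\cdot\|$ and $\langle\cdot,\cdot\rangle$ denote the Euclidean norm and inner product on $\mathbb{R}^n$. OHBK($\beta$) (Online Heavy Ball Kaczmarz with momentum parameter $\beta$) is the iterative method whose recursion is written out in the claim: at each time $t\ge1$ it receives one noiseless linear measurement $(\varphi_t,y_t)\in\mathbb{R}^n\times\mathbb{R}$ of the unknown signal $x^\ast$ (so $\langle\varphi_t,x^\ast\rangle=y_t$), projects the current iterate onto the hyperplane $\{x:\langle\varphi_t,x\rangle=y_t\}$, and adds the momentum term $\beta(x_t-x_{t-1})$. The expectation in the conclusion is over the random measurement vectors $\varphi_1,\varphi_2,\dots$. *)

theory Defs
  imports "HOL-Probability.Probability"
begin

(* The singular values of a square matrix A: the nonnegative square roots of the eigenvalues
   of A^T A.  This set is finite and nonempty, so Min and Max below are meaningful; it contains 0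
   iff A is singular. *)
definition singular_values :: "real ^ 'n ^ 'n \<Rightarrow> real set" where
  "singular_values A =
     {s. 0 \<le> s \<and> (\<exists>v. v \<noteq> 0 \<and> (transpose A ** A) *v v = s\<^sup>2 *\<^sub>R v)}"

definition sigma_min :: "real ^ 'n ^ 'n \<Rightarrow> real" where
  "sigma_min A = Min (singular_values A)"

definition sigma_max :: "real ^ 'n ^ 'n \<Rightarrow> real" where
  "sigma_max A = Max (singular_values A)"

(* Matrix-valued Bochner integral of \<phi> \<phi>^T / |\<phi>|^2.  The integrand is bounded, and it is 0 at \<phi> = 0. *)
definition kaczmarz_matrix :: "(real ^ 'n) measure \<Rightarrow> real ^ 'n ^ 'n" where
  "kaczmarz_matrix D =
     (\<integral>\<phi>. (1 / (norm \<phi>)\<^sup>2) *\<^sub>R (\<chi> i j. \<phi> $ i * \<phi> $ j) \<partial>D)"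

(* The measurements \<phi> t, y t are used for t \<ge> 1 only; on the null event \<phi> t = 0 the
   projection step does nothing, since division by zero yields zero. *)
fun ohbk :: "real \<Rightarrow> (nat \<Rightarrow> real ^ 'n) \<Rightarrow> (nat \<Rightarrow> real) \<Rightarrow> real ^ 'n \<Rightarrow> nat \<Rightarrow> real ^ 'n" where
  "ohbk \<beta> \<phi> y x0 0 = x0"
| "ohbk \<beta> \<phi> y x0 (Suc 0) = x0"
| "ohbk \<beta> \<phi> y x0 (Suc (Suc t)) =
     (let x' = ohbk \<beta> \<phi> y x0 t; x = ohbk \<beta> \<phi> y x0 (Suc t)
      in x - ((\<phi> (Suc t) \<bullet> x - y (Suc t)) / (norm (\<phi> (Suc t)))\<^sup>2) *\<^sub>R \<phi> (Suc t)
           + \<beta> *\<^sub>R (x - x'))"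

end

(* The error e_t = x_t - x* is the same iteration with all measurements 0.  The measurement at
   time t is independent of (e_t, e_{t-1}), so averaging over it replaces the projection P by W,
     E|e_{t+1}|^2 = E[ (1+2b)|e_t|^2 - 2b <e_t, e_{t-1}> + b^2 |e_t - e_{t-1}|^2
                       - (1+2b) <W e_t, e_t> + 2b <W e_t, e_{t-1}> ]     (b the momentum).
   Bounding both inner products of e_t and e_{t-1} by AM-GM, the second in the seminorm of W, gives
   E|e_{t+1}|^2 <= a E|e_t|^2 + c E|e_{t-1}|^2 with
     a = 1 + 3b + 2b^2 - (1+b) sigma_min(W),  c = b + 2b^2 + b sigma_max(W),
   and the hypothesis on b says exactly a + c < 1; one may take q = sqrt (a + c), delta = 1/q - 1. *)
theory Submission
  imports Defs
begin

section \<open>Extreme singular values as bounds of a quadratic form\<close>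

text \<open>At a zero a nonnegative quadratic form is minimal, so its gradient, a multiple of
  \<open>B u\<close>, must vanish. This turns an extremiser of a Rayleigh quotient into an
  eigenvector.\<close>

lemma psd_kernel:
  fixes B :: "'a::real_inner \<Rightarrow> 'a"
  assumes lin: "linear B" and sym: "\<And>u v. B u \<bullet> v = u \<bullet> B v"
    and psd: "\<And>u. 0 \<le> B u \<bullet> u" and Bu: "B u \<bullet> u = 0"
  shows "B u = 0"
proof (rule ccontr)
  assume "B u \<noteq> 0"
  define a where "a = B u \<bullet> B u"
  define b where "b = B (B u) \<bullet> B u"
  \<comment> \<open>A short step along \<open>- B u\<close> makes the quadratic form negative.\<close>
  define e where "e = a / (b + 1)"
  have a: "a > 0" and b: "b \<ge> 0" using \<open>B u \<noteq> 0\<close> psd by (auto simp: a_def b_def)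
  \<comment> \<open>Dividing by \<open>b + 1\<close> instead of \<open>b\<close> also covers
    \<open>b = 0\<close>.\<close>
  have e: "e > 0" "e * (b + 1) = a" using a b by (auto simp: e_def)
  interpret linear B by (rule lin)
  have "B (u - e *\<^sub>R B u) \<bullet> (u - e *\<^sub>R B u) = e * (e * b - 2 * a)"
    using sym[of "B u" u]
    by (simp add: diff scale Bu inner_diff_left inner_diff_right a_def b_def algebra_simps)
  also have "e * b - 2 * a = - a - e" using e(2) by (simp add: algebra_simps)
  also have "e * (- a - e) < 0" using e a by (simp add: mult_pos_neg)
  finally show False using psd[of "u - e *\<^sub>R B u"] by simp
qed

lemma inner_transpose_mult:
  fixes A :: "real ^ 'n ^ 'm"
  shows "(transpose A *v u) \<bullet> v = u \<bullet> (A *v v)"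
  by (simp add: dot_lmul_matrix)

lemma symmetric_inner:
  fixes A :: "real ^ 'n ^ 'n"
  assumes "transpose A = A"
  shows "(A *v u) \<bullet> v = u \<bullet> (A *v v)"
  using inner_transpose_mult[of A u v] assms by simp

text \<open>Needed before \<open>Min\<close> and \<open>Max\<close> in \<open>sigma_min\<close> and
  \<open>sigma_max\<close> can be compared with a given singular value.\<close>

lemma finite_singular_values: "finite (singular_values (A :: real ^ 'n ^ 'n))"
proof -
  define G where "G = transpose A ** A"
  \<comment> \<open>Eigenvectors of \<open>G\<close> to distinct eigenvalues are orthogonal, so there are finitely many.\<close>
  define f where "f s = (SOME v. v \<noteq> 0 \<and> G *v v = s\<^sup>2 *\<^sub>R v)" for s :: real
  have f: "f s \<noteq> 0" "G *v f s = s\<^sup>2 *\<^sub>R f s" if "s \<in> singular_values A" for s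
    using someI_ex[of "\<lambda>v. v \<noteq> 0 \<and> G *v v = s\<^sup>2 *\<^sub>R v"] that
    by (auto simp: singular_values_def G_def f_def)
  have G: "(G *v u) \<bullet> v = u \<bullet> (G *v v)" for u v
    by (rule symmetric_inner) (simp add: G_def matrix_transpose_mul)
  have orth: "f s \<bullet> f r = 0" if "s \<in> singular_values A" "r \<in> singular_values A" "s \<noteq> r" for s r
  proof -
    have "s\<^sup>2 * (f s \<bullet> f r) = r\<^sup>2 * (f s \<bullet> f r)"
      using G[of "f s" "f r"] f that by simp
    \<comment> \<open>Singular values are nonnegative, so distinct ones have distinct
      squares.\<close>
    moreover have "s\<^sup>2 \<noteq> r\<^sup>2" using that by (auto simp: singular_values_def power2_eq_iff)
    ultimately show ?thesis by simp
  qed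
  have "inj_on f (singular_values A)"
    using orth f(1) by (metis inj_onI inner_eq_zero_iff)
  moreover have "finite (f ` singular_values A)"
  proof (intro finiteI_independent pairwise_orthogonal_independent)
    show "pairwise orthogonal (f ` singular_values A)"
      using orth by (force simp: pairwise_def orthogonal_def)
  qed (use f(1) in force)
  ultimately show ?thesis using finite_image_iff by blast
qed

lemma eigenvalue_in_singular_values:
  fixes A :: "real ^ 'n ^ 'n"
  assumes "transpose A = A" "A *v v = m *\<^sub>R v" "v \<noteq> 0" "0 \<le> m"
  shows "m \<in> singular_values A"
proof -
  have "(transpose A ** A) *v v = m\<^sup>2 *\<^sub>R v"
    using assms by (simp add: matrix_vector_mul_assoc[symmetric] matrix_vector_mult_scaleR power2_eq_square)
  then show ?thesis using assms unfolding singular_values_def by blast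
qed

text \<open>The unit sphere is compact, so the form has a minimiser there; scaling extends the bound
  to every vector.\<close>

lemma rayleigh_attained:
  fixes A :: "real ^ 'n ^ 'n"
  shows "\<exists>u. norm u = 1 \<and> (\<forall>v. (A *v u) \<bullet> u * (norm v)\<^sup>2 \<le> (A *v v) \<bullet> v)"
proof -
  have cont: "continuous_on (sphere 0 1) (\<lambda>u. (A *v u) \<bullet> u)"
    by (intro continuous_intros linear_continuous_on matrix_vector_mul_bounded_linear)
  have ne: "sphere (0 :: real ^ 'n) 1 \<noteq> {}" by simp
  obtain u where u: "u \<in> sphere 0 1" "\<And>v. v \<in> sphere 0 1 \<Longrightarrow> (A *v u) \<bullet> u \<le> (A *v v) \<bullet> v"
    using continuous_attains_inf[OF compact_sphere ne cont] by blast
  have "(A *v u) \<bullet> u * (norm v)\<^sup>2 \<le> (A *v v) \<bullet> v" for v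
  proof (cases "v = 0")
    case False
    then have "(A *v u) \<bullet> u \<le> (A *v (v /\<^sub>R norm v)) \<bullet> (v /\<^sub>R norm v)"
      by (intro u(2)) simp
    then show ?thesis using False
      by (simp add: matrix_vector_mult_scaleR field_simps power2_eq_square)
  qed simp
  then show ?thesis using u(1) by auto
qed

text \<open>The minimum of the Rayleigh quotient is an eigenvalue, nonnegative by
  \<open>psd\<close>, hence itself a singular value, and \<open>sigma_min A\<close> cannot exceed
  it.\<close>

lemma sigma_min_le_rayleigh:
  fixes A :: "real ^ 'n ^ 'n"
  assumes sym: "transpose A = A" and psd: "\<And>u. 0 \<le> (A *v u) \<bullet> u"
  shows "sigma_min A * (norm v)\<^sup>2 \<le> (A *v v) \<bullet> v"
proof -
  obtain u where u: "norm u = 1" "\<And>v. (A *v u) \<bullet> u * (norm v)\<^sup>2 \<le> (A *v v) \<bullet> v"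
    using rayleigh_attained[of A] by blast
  define m where "m = (A *v u) \<bullet> u"
  \<comment> \<open>\<open>A - m\<close> is positive semidefinite and its form vanishes at the minimiser \<open>u\<close>.\<close>
  have "A *v u - m *\<^sub>R u = 0"
  proof (rule psd_kernel[where B = "\<lambda>w. A *v w - m *\<^sub>R w"])
    show "linear (\<lambda>w. A *v w - m *\<^sub>R w)"
      by (rule linearI) (simp_all add: matrix_vector_right_distrib matrix_vector_mult_scaleR algebra_simps)
    show "(A *v w - m *\<^sub>R w) \<bullet> w' = w \<bullet> (A *v w' - m *\<^sub>R w')" for w w'
      by (simp add: inner_diff_left inner_diff_right symmetric_inner[OF sym])
    show "0 \<le> (A *v w - m *\<^sub>R w) \<bullet> w" for w
      using u(2)[of w] by (simp add: inner_diff_left m_def power2_norm_eq_inner)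
    show "(A *v u - m *\<^sub>R u) \<bullet> u = 0"
      using u(1) by (simp add: inner_diff_left m_def flip: power2_norm_eq_inner)
  qed
  then have "m \<in> singular_values A"
    using u(1) psd[of u] by (intro eigenvalue_in_singular_values[OF sym, of u]) (auto simp: m_def)
  then have "sigma_min A \<le> m" unfolding sigma_min_def by (intro Min_le finite_singular_values)
  then show ?thesis using u(2)[of v] mult_right_mono[of "sigma_min A" m "(norm v)\<^sup>2"]
    by (simp add: m_def)
qed

text \<open>Minimising the form of \<open>- A\<close> gives a maximiser for \<open>A\<close>; the
  argument for the minimum then runs with \<open>m - A\<close> as the semidefinite map.\<close>

lemma rayleigh_le_sigma_max:
  fixes A :: "real ^ 'n ^ 'n"
  assumes sym: "transpose A = A" and psd: "\<And>u. 0 \<le> (A *v u) \<bullet> u"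
  shows "(A *v v) \<bullet> v \<le> sigma_max A * (norm v)\<^sup>2"
proof -
  have neg: "(- A) *v w = - (A *v w)" for w
    by (simp add: vec_eq_iff matrix_vector_mult_def sum_negf)
  obtain u where u: "norm u = 1" "\<And>v. (A *v v) \<bullet> v \<le> (A *v u) \<bullet> u * (norm v)\<^sup>2"
    using rayleigh_attained[of "- A"] by (auto simp: neg)
  define m where "m = (A *v u) \<bullet> u"
  have "m *\<^sub>R u - A *v u = 0"
  proof (rule psd_kernel[where B = "\<lambda>w. m *\<^sub>R w - A *v w"])
    show "linear (\<lambda>w. m *\<^sub>R w - A *v w)"
      by (rule linearI) (simp_all add: matrix_vector_right_distrib matrix_vector_mult_scaleR algebra_simps)
    show "(m *\<^sub>R w - A *v w) \<bullet> w' = w \<bullet> (m *\<^sub>R w' - A *v w')" for w w'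
      by (simp add: inner_diff_left inner_diff_right symmetric_inner[OF sym])
    show "0 \<le> (m *\<^sub>R w - A *v w) \<bullet> w" for w
      using u(2)[of w] by (simp add: inner_diff_left m_def power2_norm_eq_inner)
    show "(m *\<^sub>R u - A *v u) \<bullet> u = 0"
      using u(1) by (simp add: inner_diff_left m_def flip: power2_norm_eq_inner)
  qed
  then have "m \<in> singular_values A"
    using u(1) psd[of u] by (intro eigenvalue_in_singular_values[OF sym, of u]) (auto simp: m_def)
  then have "m \<le> sigma_max A" unfolding sigma_max_def by (intro Max_ge finite_singular_values)
  then show ?thesis using u(2)[of v] mult_right_mono[of m "sigma_max A" "(norm v)\<^sup>2"]
    by (simp add: m_def)
qed

section \<open>Projection onto the line of a measurement vector\<close>

text \<open>Since x/0 = 0, the projection onto the line spanned by 0 is the zero map, as it should be.\<close>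

definition line_proj :: "'a::real_inner \<Rightarrow> 'a \<Rightarrow> 'a" where
  "line_proj \<phi> u = ((\<phi> \<bullet> u) / (norm \<phi>)\<^sup>2) *\<^sub>R \<phi>"

lemma line_proj_inner: "line_proj \<phi> u \<bullet> v = (\<phi> \<bullet> u) * (\<phi> \<bullet> v) / (norm \<phi>)\<^sup>2"
  by (simp add: line_proj_def)

text \<open>The projection is self-adjoint and idempotent. Terms quadratic in it thus become linear
  in it, and only linear ones average to \<open>W\<close>.\<close>

lemma line_proj_inner_self: "line_proj \<phi> u \<bullet> line_proj \<phi> v = line_proj \<phi> u \<bullet> v"
  by (simp add: line_proj_def power2_norm_eq_inner)

lemma line_proj_nonneg: "0 \<le> line_proj \<phi> u \<bullet> u"
  by (simp add: line_proj_inner)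

lemma norm_line_proj_le: "norm (line_proj \<phi> u) \<le> norm u"
  using Cauchy_Schwarz_ineq2[of \<phi> u]
  by (cases "\<phi> = 0") (auto simp: line_proj_def field_simps power2_eq_square)

lemma abs_line_proj_inner_le: "\<bar>line_proj \<phi> u \<bullet> v\<bar> \<le> norm u * norm v"
  using Cauchy_Schwarz_ineq2[of "line_proj \<phi> u" v] norm_line_proj_le[of \<phi> u]
  by (meson mult_right_mono norm_ge_zero order_trans)

lemma norm_diff_line_proj_le: "norm (u - line_proj \<phi> u) \<le> norm u"
proof (rule power2_le_imp_le)
  have "(norm (u - line_proj \<phi> u))\<^sup>2 = (norm u)\<^sup>2 - line_proj \<phi> u \<bullet> u"
    by (simp add: power2_norm_eq_inner inner_diff_left inner_diff_right line_proj_inner_self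
        inner_commute[of u "line_proj \<phi> u"])
  then show "(norm (u - line_proj \<phi> u))\<^sup>2 \<le> (norm u)\<^sup>2" using line_proj_nonneg[of \<phi> u] by simp
qed simp

lemma borel_measurable_line_proj [measurable (raw)]:
  fixes f g :: "'b \<Rightarrow> real ^ 'n"
  assumes [measurable]: "f \<in> borel_measurable N" "g \<in> borel_measurable N"
  shows "(\<lambda>\<omega>. line_proj (f \<omega>) (g \<omega>)) \<in> borel_measurable N"
  unfolding line_proj_def by measurable

section \<open>The mean projection \<open>kaczmarz_matrix\<close>\<close>

text \<open>The matrix norm here is the Frobenius norm, under which the outer product of \<phi> with
  itself has norm |\<phi>|^2; the integrand is therefore bounded by 1.\<close>

lemma integrable_kaczmarz_kernel:
  fixes D :: "(real ^ 'n) measure"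
  assumes "prob_space D" and sets: "sets D = sets borel"
  shows "integrable D (\<lambda>\<phi>. (1 / (norm \<phi>)\<^sup>2) *\<^sub>R (\<chi> i j. \<phi> $ i * \<phi> $ j) :: real ^ 'n ^ 'n)"
proof -
  interpret prob_space D by fact
  have [measurable_cong]: "sets D = sets borel" by (rule sets)
  have [measurable]: "(\<lambda>\<phi> :: real ^ 'n. (\<chi> i j. \<phi> $ i * \<phi> $ j) :: real ^ 'n ^ 'n) \<in> borel_measurable borel"
    by (intro borel_measurable_continuous_onI continuous_on_vec_lambda continuous_intros)
  have outer: "norm ((\<chi> i j. \<phi> $ i * \<phi> $ j) :: real ^ 'n ^ 'n) = (norm \<phi>)\<^sup>2" for \<phi> :: "real ^ 'n"
  proof -
    have "(norm ((\<chi> i j. \<phi> $ i * \<phi> $ j) :: real ^ 'n ^ 'n))\<^sup>2 = ((norm \<phi>)\<^sup>2)\<^sup>2"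
      unfolding power2_norm_eq_inner
      by (simp add: inner_vec_def power2_eq_square sum_product algebra_simps)
    then show ?thesis by (subst (asm) power2_eq_iff_nonneg) auto
  qed
  have "norm ((1 / (norm \<phi>)\<^sup>2) *\<^sub>R ((\<chi> i j. \<phi> $ i * \<phi> $ j) :: real ^ 'n ^ 'n)) \<le> 1"
    for \<phi> :: "real ^ 'n"
    unfolding norm_scaleR outer by simp
  then show ?thesis by (intro integrable_const_bound[where B = 1]) auto
qed

text \<open>For fixed \<open>u\<close> and \<open>v\<close> the form is a bounded linear functional
  of the matrix, so it commutes with the Bochner integral.\<close>

lemma kaczmarz_matrix_inner:
  fixes D :: "(real ^ 'n) measure"
  assumes "prob_space D" "sets D = sets borel"
  shows "(kaczmarz_matrix D *v u) \<bullet> v = (\<integral>\<phi>. line_proj \<phi> u \<bullet> v \<partial>D)"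
proof -
  define T where "T A = (A *v u) \<bullet> v" for A :: "real ^ 'n ^ 'n"
  have "linear T"
    by (rule linearI)
       (auto simp: T_def inner_add_left matrix_vector_mult_add_rdistrib scaleR_matrix_vector_assoc[symmetric])
  then have T: "bounded_linear T" by (simp add: linear_conv_bounded_linear)
  have outer: "(\<chi> i j. \<phi> $ i * \<phi> $ j) *v u = (\<phi> \<bullet> u) *\<^sub>R \<phi>" for \<phi> :: "real ^ 'n"
    by (simp add: vec_eq_iff matrix_vector_mult_def inner_vec_def sum_distrib_left sum_distrib_right mult_ac)
  have "T ((1 / (norm \<phi>)\<^sup>2) *\<^sub>R (\<chi> i j. \<phi> $ i * \<phi> $ j)) = line_proj \<phi> u \<bullet> v" for \<phi>
    by (simp add: T_def outer line_proj_def scaleR_matrix_vector_assoc[symmetric])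
  then show ?thesis
    using integral_bounded_linear[OF T integrable_kaczmarz_kernel[OF assms]]
    by (simp add: T_def kaczmarz_matrix_def)
qed

lemma transpose_kaczmarz_matrix:
  fixes D :: "(real ^ 'n) measure"
  assumes "prob_space D" "sets D = sets borel"
  shows "transpose (kaczmarz_matrix D) = kaczmarz_matrix D"
proof -
  have "(transpose (kaczmarz_matrix D) *v u) \<bullet> v = (kaczmarz_matrix D *v u) \<bullet> v" for u v
    unfolding inner_transpose_mult inner_commute[of u] kaczmarz_matrix_inner[OF assms]
    by (simp add: line_proj_inner mult.commute)
  then show ?thesis by (metis matrix_eq vector_eq_rdot)
qed

lemma kaczmarz_matrix_psd:
  fixes D :: "(real ^ 'n) measure"
  assumes "prob_space D" "sets D = sets borel"
  shows "0 \<le> (kaczmarz_matrix D *v u) \<bullet> u"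
  unfolding kaczmarz_matrix_inner[OF assms] by (simp add: line_proj_nonneg)

text \<open>A mean of projections is at most the identity. This caps \<open>sigma_min\<close> at 1,
  which keeps the first recursion coefficient positive.\<close>

lemma kaczmarz_matrix_le_norm:
  fixes D :: "(real ^ 'n) measure"
  assumes "prob_space D" "sets D = sets borel"
  shows "(kaczmarz_matrix D *v u) \<bullet> u \<le> (norm u)\<^sup>2"
proof -
  interpret prob_space D by fact
  have [measurable_cong]: "sets D = sets borel" by fact
  have "integrable D (\<lambda>\<phi>. line_proj \<phi> u \<bullet> u)"
    using abs_line_proj_inner_le
    by (intro integrable_const_bound[where B = "norm u * norm u"]) auto
  then show ?thesis
    unfolding kaczmarz_matrix_inner[OF assms]
    using abs_line_proj_inner_le[of _ u u]
    by (intro integral_le_const) (auto simp: power2_eq_square abs_le_iff)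
qed

text \<open>By independence the joint law is a product, so Fubini allows integrating over
  \<open>X\<close> first with \<open>Y\<close> frozen; that inner integral is the form of the mean
  projection. In the application \<open>X\<close> is the current measurement and \<open>Y\<close>
  the block of past ones.\<close>

lemma (in prob_space) expectation_line_proj_indep:
  fixes f u v :: "'b \<Rightarrow> real ^ 'n"
  assumes ind: "indep_var S X T Y"
    and f[measurable]: "f \<in> borel_measurable S"
    and u[measurable]: "u \<in> borel_measurable T" and v[measurable]: "v \<in> borel_measurable T"
    and int: "integrable M (\<lambda>\<omega>. line_proj (f (X \<omega>)) (u (Y \<omega>)) \<bullet> v (Y \<omega>))"
  shows "expectation (\<lambda>\<omega>. line_proj (f (X \<omega>)) (u (Y \<omega>)) \<bullet> v (Y \<omega>)) =
    expectation (\<lambda>\<omega>. (kaczmarz_matrix (distr M borel (\<lambda>\<omega>. f (X \<omega>))) *v u (Y \<omega>)) \<bullet> v (Y \<omega>))"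
proof -
  let ?D = "distr M borel (\<lambda>\<omega>. f (X \<omega>))"
  let ?P = "distr M S X" and ?Q = "distr M T Y"
  let ?h = "\<lambda>a b. line_proj (f a) (u b) \<bullet> v b"
  have X[measurable]: "X \<in> measurable M S" and Y[measurable]: "Y \<in> measurable M T"
    and eq: "?P \<Otimes>\<^sub>M ?Q = distr M (S \<Otimes>\<^sub>M T) (\<lambda>\<omega>. (X \<omega>, Y \<omega>))"
    using ind unfolding indep_var_distribution_eq by auto
  have D: "prob_space ?D" by (rule prob_space_distr) simp
  interpret P: prob_space ?P by (rule prob_space_distr) simp
  interpret Q: prob_space ?Q by (rule prob_space_distr) simp
  interpret PQ: pair_sigma_finite ?P ?Q ..
  have W[measurable]: "(\<lambda>a. kaczmarz_matrix ?D *v a) \<in> borel_measurable borel"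
    by (intro borel_measurable_continuous_onI linear_continuous_on matrix_vector_mul_bounded_linear)
  have "expectation (\<lambda>\<omega>. ?h (X \<omega>) (Y \<omega>)) = integral\<^sup>L (?P \<Otimes>\<^sub>M ?Q) (case_prod ?h)"
    unfolding eq by (subst integral_distr) auto
  also have "\<dots> = (\<integral>b. (\<integral>a. ?h a b \<partial>?P) \<partial>?Q)"
  proof (rule PQ.integral_snd[symmetric])
    show "integrable (?P \<Otimes>\<^sub>M ?Q) (case_prod ?h)"
      unfolding eq using int by (subst integrable_distr_eq) auto
  qed
  also have "\<dots> = (\<integral>b. (kaczmarz_matrix ?D *v u b) \<bullet> v b \<partial>?Q)"
    by (intro Bochner_Integration.integral_cong refl)
       (simp add: kaczmarz_matrix_inner[OF D] integral_distr)
  also have "\<dots> = expectation (\<lambda>\<omega>. (kaczmarz_matrix ?D *v u (Y \<omega>)) \<bullet> v (Y \<omega>))"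
    by (subst integral_distr) auto
  finally show ?thesis .
qed

section \<open>The error iterates: recursion, growth, dependence on the past\<close>

lemma ohbk_diff_solution:
  assumes "\<And>s. s \<ge> 1 \<Longrightarrow> y s = \<phi> s \<bullet> xstar"
  shows "ohbk \<beta> \<phi> y x0 t - xstar = ohbk \<beta> \<phi> (\<lambda>_. 0) (x0 - xstar) t"
proof (induction t rule: induct_nat_012)
  case (ge2 t)
  show ?case
    by (simp add: Let_def assms flip: ge2) (simp add: inner_diff_right algebra_simps)
qed auto

lemma ohbk_homogeneous_Suc:
  "ohbk \<beta> \<phi> (\<lambda>_. 0) e (Suc (Suc t)) =
    (ohbk \<beta> \<phi> (\<lambda>_. 0) e (Suc t) - line_proj (\<phi> (Suc t)) (ohbk \<beta> \<phi> (\<lambda>_. 0) e (Suc t))) +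
    \<beta> *\<^sub>R (ohbk \<beta> \<phi> (\<lambda>_. 0) e (Suc t) - ohbk \<beta> \<phi> (\<lambda>_. 0) e t)"
  by (simp add: Let_def line_proj_def)

text \<open>A crude bound, uniform in the measurements, whose purpose is integrability: at each time
  the error is a bounded random vector.\<close>

lemma norm_ohbk_homogeneous_le:
  assumes "0 \<le> \<beta>" "\<beta> \<le> 1"
  shows "norm (ohbk \<beta> \<phi> (\<lambda>_. 0) e t) \<le> 3 ^ t * norm e"
proof (induction t rule: induct_nat_012)
  case (ge2 t)
  let ?u = "ohbk \<beta> \<phi> (\<lambda>_. 0) e (Suc t)" and ?v = "ohbk \<beta> \<phi> (\<lambda>_. 0) e t"
  have "0 \<le> 3 ^ t * norm e" by simp
  have "norm (ohbk \<beta> \<phi> (\<lambda>_. 0) e (Suc (Suc t))) \<le>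
      norm (?u - line_proj (\<phi> (Suc t)) ?u) + norm (\<beta> *\<^sub>R (?u - ?v))"
    unfolding ohbk_homogeneous_Suc by (rule norm_triangle_ineq)
  also have "\<dots> \<le> norm ?u + 1 * (norm ?u + norm ?v)"
    using assms unfolding norm_scaleR
    by (intro add_mono mult_mono norm_diff_line_proj_le norm_triangle_ineq4) auto
  \<comment> \<open>In units of \<open>3 ^ t * norm e\<close> the left side is at most 2 * 3 + 1 =
    7, the right side is 9.\<close>
  also have "\<dots> \<le> 3 ^ Suc (Suc t) * norm e"
    using ge2 \<open>0 \<le> 3 ^ t * norm e\<close> unfolding power_Suc mult.assoc mult_1_left
    by linarith
  finally show ?case .
qed (use norm_ge_zero[of e] in auto)

text \<open>Iterate \<open>t\<close> uses only the measurements before time \<open>t\<close>. This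
  is what makes the measurement at time \<open>t\<close> independent of it.\<close>

lemma ohbk_cong:
  assumes "\<And>s. 1 \<le> s \<Longrightarrow> s < t \<Longrightarrow> \<phi> s = \<psi> s"
  shows "ohbk \<beta> \<phi> (\<lambda>_. 0) e t = ohbk \<beta> \<psi> (\<lambda>_. 0) e t"
  using assms by (induction t rule: induct_nat_012) (auto simp: Let_def)

text \<open>\<open>I\<close> may be larger than the set of times used, so that two successive
  iterates can be viewed on one product space.\<close>

lemma borel_measurable_ohbk:
  assumes "{1..<t} \<subseteq> I"
  shows "(\<lambda>f. ohbk \<beta> f (\<lambda>_. 0) e t) \<in> borel_measurable (PiM I (\<lambda>_. borel :: (real ^ 'n) measure))"
  using assms
proof (induction t rule: induct_nat_012)
  case (ge2 t)
  have "Suc t \<in> I" using ge2.prems by auto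
  then have [measurable]: "(\<lambda>f. f (Suc t)) \<in> borel_measurable (PiM I (\<lambda>_. borel :: (real ^ 'n) measure))"
    by (rule measurable_component_singleton)
  have [measurable]: "(\<lambda>f. ohbk \<beta> f (\<lambda>_. 0) e (Suc t)) \<in> borel_measurable (PiM I (\<lambda>_. borel))"
    "(\<lambda>f. ohbk \<beta> f (\<lambda>_. 0) e t) \<in> borel_measurable (PiM I (\<lambda>_. borel))"
    by (rule ge2.IH, rule order_trans[OF _ ge2.prems], force)+
  show ?case unfolding ohbk_homogeneous_Suc by measurable
qed simp_all

section \<open>Deterministic estimates for one step and for the recursion\<close>

lemma norm_heavy_ball_step:
  "(norm ((u - line_proj \<phi> u) + \<beta> *\<^sub>R (u - v)))\<^sup>2 =
    (1 + 2 * \<beta>) * (norm u)\<^sup>2 - 2 * \<beta> * (u \<bullet> v) + \<beta>\<^sup>2 * (norm (u - v))\<^sup>2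
    - (1 + 2 * \<beta>) * (line_proj \<phi> u \<bullet> u) + 2 * \<beta> * (line_proj \<phi> u \<bullet> v)"
  unfolding power2_norm_eq_inner
  by (simp add: inner_add_left inner_add_right inner_diff_left inner_diff_right line_proj_inner_self
      inner_commute[of u "line_proj \<phi> u"] inner_commute[of v "line_proj \<phi> u"] inner_commute[of v u]
      power2_eq_square algebra_simps)

lemma averaged_heavy_ball_step_le:
  fixes A :: "real ^ 'n ^ 'n"
  assumes sym: "transpose A = A" and psd: "\<And>u. 0 \<le> (A *v u) \<bullet> u" and \<beta>: "0 \<le> \<beta>"
  shows "(1 + 2 * \<beta>) * (norm u)\<^sup>2 - 2 * \<beta> * (u \<bullet> v) + \<beta>\<^sup>2 * (norm (u - v))\<^sup>2
      - (1 + 2 * \<beta>) * ((A *v u) \<bullet> u) + 2 * \<beta> * ((A *v u) \<bullet> v)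
    \<le> (1 + 3 * \<beta> + 2 * \<beta>\<^sup>2 - (1 + \<beta>) * sigma_min A) * (norm u)\<^sup>2
      + (\<beta> + 2 * \<beta>\<^sup>2 + \<beta> * sigma_max A) * (norm v)\<^sup>2"
proof -
  \<comment> \<open>AM-GM in the seminorm of \<open>A\<close>: expand the form at
    \<open>u - v\<close>.\<close>
  have "2 * ((A *v u) \<bullet> v) \<le> (A *v u) \<bullet> u + (A *v v) \<bullet> v"
    using psd[of "u - v"] symmetric_inner[OF sym, of v u]
    by (simp add: matrix_vector_mult_diff_distrib inner_diff_left inner_diff_right inner_commute[of v])
  then have "2 * ((A *v u) \<bullet> v) \<le> (A *v u) \<bullet> u + sigma_max A * (norm v)\<^sup>2"
    using rayleigh_le_sigma_max[OF sym psd, of v] by simp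
  from mult_left_mono[OF this \<beta>]
  have 1: "2 * \<beta> * ((A *v u) \<bullet> v) \<le> \<beta> * ((A *v u) \<bullet> u) + \<beta> * sigma_max A * (norm v)\<^sup>2"
    by (simp add: algebra_simps)
  \<comment> \<open>Of the \<open>1 + 2 * \<beta>\<close> copies of the form at \<open>u\<close>,
    the cross term has consumed \<beta>; the remaining \<open>1 + \<beta>\<close> are bounded below
    by \<open>sigma_min A\<close>.\<close>
  have 2: "(1 + \<beta>) * (sigma_min A * (norm u)\<^sup>2) \<le> (1 + \<beta>) * ((A *v u) \<bullet> u)"
    using \<beta> sigma_min_le_rayleigh[OF sym psd, of u] by (intro mult_left_mono) auto
  \<comment> \<open>Expanding |u + v|^2 bounds \<open>- (u \<bullet> v)\<close> from above, which
    serves both the inner product term and |u - v|^2.\<close>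
  have plus: "0 \<le> (norm u)\<^sup>2 + 2 * (u \<bullet> v) + (norm v)\<^sup>2"
    using zero_le_power2[of "norm (u + v)"]
    by (simp add: power2_norm_eq_inner inner_add_left inner_add_right inner_commute[of v u])
  have 3: "- (2 * \<beta> * (u \<bullet> v)) \<le> \<beta> * ((norm u)\<^sup>2 + (norm v)\<^sup>2)"
    using mult_left_mono[OF plus \<beta>] by (simp add: algebra_simps)
  have "(norm (u - v))\<^sup>2 \<le> 2 * ((norm u)\<^sup>2 + (norm v)\<^sup>2)"
    using plus by (simp add: power2_norm_eq_inner inner_diff_left inner_diff_right inner_commute[of v u])
  from mult_left_mono[OF this zero_le_power2[of \<beta>]]
  have 4: "\<beta>\<^sup>2 * (norm (u - v))\<^sup>2 \<le> 2 * \<beta>\<^sup>2 * ((norm u)\<^sup>2 + (norm v)\<^sup>2)" by (simp add: algebra_simps)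
  show ?thesis using 1 2 3 4 by (simp add: algebra_simps)
qed

text \<open>Induction with a geometric majorant. As \<open>F 1 = F 0\<close>, its constant must be
  at least \<open>F 0 / q\<close> to cover time 1.\<close>

lemma two_step_recursion_bound:
  fixes F :: "nat \<Rightarrow> real"
  assumes a: "0 \<le> a" and b: "0 \<le> b" and q: "0 < q" "q \<le> 1" and ab: "a + b \<le> q\<^sup>2"
    and F0: "0 \<le> F 0" "F 1 = F 0" and rec: "\<And>t. F (Suc (Suc t)) \<le> a * F (Suc t) + b * F t"
  shows "F t \<le> q ^ t * (F 0 / q)"
proof (induction t rule: induct_nat_012)
  case 0
  show ?case using q F0 mult_right_mono[of q 1 "F 0"] by (simp add: field_simps)
next
  case 1
  show ?case using q F0 by simp
next
  case (ge2 t)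
  \<comment> \<open>Since \<open>q \<le> 1\<close>, lowering the weight of \<open>a\<close> from 1
    to \<open>q\<close> only helps; no root of the characteristic equation has to be
    computed.\<close>
  have "a * q + b \<le> q\<^sup>2" using ab a q mult_left_mono[of q 1 a] by simp
  have "F (Suc (Suc t)) \<le> a * (q ^ Suc t * (F 0 / q)) + b * (q ^ t * (F 0 / q))"
    using rec[of t] mult_left_mono[OF ge2(1) b] mult_left_mono[OF ge2(2) a] by linarith
  also have "\<dots> = (a * q + b) * (q ^ t * (F 0 / q))"
    by (simp add: distrib_right distrib_left mult_ac del: times_divide_eq_right times_divide_eq_left)
  also have "\<dots> \<le> q\<^sup>2 * (q ^ t * (F 0 / q))"
    using \<open>a * q + b \<le> q\<^sup>2\<close> q F0 by (intro mult_right_mono) auto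
  finally show ?case by (simp only: power_Suc power2_eq_square mult.assoc)
qed

section \<open>The recursion for the mean squared error\<close>

lemma (in prob_space) expectation_ohbk_step:
  fixes \<phi> :: "nat \<Rightarrow> 'a \<Rightarrow> real ^ 'n" and e :: "real ^ 'n"
  assumes D: "prob_space D" "sets D = sets borel"
    and indep: "indep_vars (\<lambda>_. borel) \<phi> {1..}"
    and distr: "\<And>t. t \<ge> 1 \<Longrightarrow> distr M borel (\<phi> t) = D"
    and \<beta>: "0 \<le> \<beta>" "\<beta> \<le> 1"
  defines "E \<equiv> \<lambda>t \<omega>. ohbk \<beta> (\<lambda>s. \<phi> s \<omega>) (\<lambda>_. 0) e t"
  shows "integrable M (\<lambda>\<omega>. (norm (E t \<omega>))\<^sup>2)"
    and "expectation (\<lambda>\<omega>. (norm (E (Suc (Suc t)) \<omega>))\<^sup>2) \<le>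
      (1 + 3 * \<beta> + 2 * \<beta>\<^sup>2 - (1 + \<beta>) * sigma_min (kaczmarz_matrix D)) * expectation (\<lambda>\<omega>. (norm (E (Suc t) \<omega>))\<^sup>2)
      + (\<beta> + 2 * \<beta>\<^sup>2 + \<beta> * sigma_max (kaczmarz_matrix D)) * expectation (\<lambda>\<omega>. (norm (E t \<omega>))\<^sup>2)"
proof -
  let ?W = "kaczmarz_matrix D"
  have \<phi>[measurable]: "\<phi> t \<in> borel_measurable M" if "t \<ge> 1" for t
    using indep that by (auto simp: indep_vars_def)
  define G where "G t = (\<lambda>f. ohbk \<beta> f (\<lambda>_. 0) e t)" for t
  define H where "H I \<omega> = restrict (\<lambda>s. \<phi> s \<omega>) I" for I \<omega>
  \<comment> \<open>The error is a fixed function \<open>G t\<close> of any block of measurements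
    containing times 1 to \<open>t - 1\<close>.\<close>
  have E: "E t \<omega> = G t (H I \<omega>)" if "{1..<t} \<subseteq> I" for t I \<omega>
    unfolding E_def G_def H_def using that by (intro ohbk_cong) auto
  have Em[measurable]: "E t \<in> borel_measurable M" for t
  proof -
    have "H {1..<t} \<in> measurable M (PiM {1..<t} (\<lambda>_. borel))"
      unfolding H_def by (intro measurable_restrict) auto
    moreover have "E t = (\<lambda>\<omega>. G t (H {1..<t} \<omega>))" using E[of t "{1..<t}"] by auto
    ultimately show ?thesis
      using borel_measurable_ohbk[of t "{1..<t}" \<beta> e] unfolding G_def
      by (auto intro: measurable_compose)
  qed
  have Eb: "norm (E t \<omega>) \<le> 3 ^ t * norm e" for t \<omega>
    unfolding E_def by (rule norm_ohbk_homogeneous_le[OF \<beta>])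
  \<comment> \<open>Every integrand below reduces to terms dominated by a product of two error
    norms, hence bounded by a constant.\<close>
  have prod_int: "integrable M f" if [measurable]: "f \<in> borel_measurable M"
    and f: "\<And>\<omega>. \<bar>f \<omega>\<bar> \<le> norm (E s \<omega>) * norm (E t \<omega>)" for f s t
    using order_trans[OF f mult_mono[OF Eb Eb]]
    by (intro integrable_const_bound[where B = "(3 ^ s * norm e) * (3 ^ t * norm e)"]) auto
  show int: "integrable M (\<lambda>\<omega>. (norm (E t \<omega>))\<^sup>2)" for t
    by (rule prod_int[of _ t t]) (auto simp: power2_eq_square)
  have inner_int: "integrable M (\<lambda>\<omega>. E s \<omega> \<bullet> E t \<omega>)" for s t
    by (rule prod_int[of _ s t]) (auto simp: Cauchy_Schwarz_ineq2)
  have diff_int: "integrable M (\<lambda>\<omega>. (norm (E s \<omega> - E t \<omega>))\<^sup>2)" for s t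
    unfolding power2_norm_eq_inner inner_diff_left inner_diff_right
    by (intro Bochner_Integration.integrable_diff inner_int)
  have W_int: "integrable M (\<lambda>\<omega>. (?W *v E s \<omega>) \<bullet> E t \<omega>)" for s t
  proof -
    \<comment> \<open>In coordinates the form is a finite combination of products that
      \<open>prod_int\<close> handles.\<close>
    have expand: "(?W *v a) \<bullet> b = (\<Sum>i\<in>UNIV. \<Sum>j\<in>UNIV. ?W $ i $ j * (a $ j * b $ i))" for a b
      by (simp add: inner_vec_def matrix_vector_mult_def sum_distrib_right mult.assoc)
    have [measurable]: "(\<lambda>\<omega>. E r \<omega> $ i) \<in> borel_measurable M" for r i
      by (rule measurable_compose[OF Em borel_measurable_continuous_onI]) (intro continuous_intros)
    have "integrable M (\<lambda>\<omega>. E s \<omega> $ j * E t \<omega> $ i)" for i j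
      by (rule prod_int[of _ s t])
         (auto simp: abs_mult intro!: mult_mono component_le_norm_cart)
    then show ?thesis unfolding expand by auto
  qed
  let ?u = "E (Suc t)" and ?v = "E t" and ?p = "\<phi> (Suc t)"
  have P_int: "integrable M (\<lambda>\<omega>. line_proj (?p \<omega>) (?u \<omega>) \<bullet> E s \<omega>)" for s
    by (rule prod_int[of _ "Suc t" s]) (auto simp: abs_line_proj_inner_le)
  have P_exp: "expectation (\<lambda>\<omega>. line_proj (?p \<omega>) (?u \<omega>) \<bullet> E s \<omega>) =
      expectation (\<lambda>\<omega>. (?W *v ?u \<omega>) \<bullet> E s \<omega>)" if "s \<le> Suc t" for s
  proof -
    \<comment> \<open>The current time against all earlier ones. For \<open>s \<le> Suc t\<close>
      both \<open>?u\<close> and \<open>E s\<close> are functions of the block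
      \<open>?B\<close>.\<close>
    let ?A = "{Suc t}" and ?B = "{1..<Suc t}"
    have ind: "indep_var (PiM ?A (\<lambda>_. borel)) (H ?A) (PiM ?B (\<lambda>_. borel)) (H ?B)"
      unfolding H_def by (rule indep_var_restrict[OF indep]) auto
    have E': "?u \<omega> = G (Suc t) (H ?B \<omega>)" "E s \<omega> = G s (H ?B \<omega>)" for \<omega>
      using that by (auto intro!: E)
    have p: "?p \<omega> = H ?A \<omega> (Suc t)" for \<omega> by (simp add: H_def)
    have "distr M borel (\<lambda>\<omega>. H ?A \<omega> (Suc t)) = D"
      using distr[of "Suc t"] by (simp add: H_def)
    moreover have "G (Suc t) \<in> borel_measurable (PiM ?B (\<lambda>_. borel))"
      "G s \<in> borel_measurable (PiM ?B (\<lambda>_. borel))"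
      unfolding G_def using that by (auto intro!: borel_measurable_ohbk)
    ultimately show ?thesis
      using expectation_line_proj_indep[OF ind, of "\<lambda>f. f (Suc t)" "G (Suc t)" "G s"] P_int[of s]
      by (simp add: E' p)
  qed
  have "expectation (\<lambda>\<omega>. (norm (E (Suc (Suc t)) \<omega>))\<^sup>2) = expectation (\<lambda>\<omega>.
      (1 + 2 * \<beta>) * (norm (?u \<omega>))\<^sup>2 - 2 * \<beta> * (?u \<omega> \<bullet> ?v \<omega>) + \<beta>\<^sup>2 * (norm (?u \<omega> - ?v \<omega>))\<^sup>2
      - (1 + 2 * \<beta>) * (line_proj (?p \<omega>) (?u \<omega>) \<bullet> ?u \<omega>)
      + 2 * \<beta> * (line_proj (?p \<omega>) (?u \<omega>) \<bullet> ?v \<omega>))"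
    unfolding E_def ohbk_homogeneous_Suc norm_heavy_ball_step ..
  \<comment> \<open>Only the two projection terms change, by \<open>P_exp\<close> at
    \<open>s = Suc t\<close> and \<open>s = t\<close>.\<close>
  also have "\<dots> = expectation (\<lambda>\<omega>.
      (1 + 2 * \<beta>) * (norm (?u \<omega>))\<^sup>2 - 2 * \<beta> * (?u \<omega> \<bullet> ?v \<omega>) + \<beta>\<^sup>2 * (norm (?u \<omega> - ?v \<omega>))\<^sup>2
      - (1 + 2 * \<beta>) * ((?W *v ?u \<omega>) \<bullet> ?u \<omega>) + 2 * \<beta> * ((?W *v ?u \<omega>) \<bullet> ?v \<omega>))"
    using P_exp[of t] P_exp[of "Suc t"] by (simp add: int inner_int diff_int P_int W_int)
  also have "\<dots> \<le> expectation (\<lambda>\<omega>.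
      (1 + 3 * \<beta> + 2 * \<beta>\<^sup>2 - (1 + \<beta>) * sigma_min ?W) * (norm (?u \<omega>))\<^sup>2
      + (\<beta> + 2 * \<beta>\<^sup>2 + \<beta> * sigma_max ?W) * (norm (?v \<omega>))\<^sup>2)"
    by (intro integral_mono averaged_heavy_ball_step_le transpose_kaczmarz_matrix[OF D]
        kaczmarz_matrix_psd[OF D] \<beta>) (simp_all add: int inner_int diff_int W_int)
  also have "\<dots> = (1 + 3 * \<beta> + 2 * \<beta>\<^sup>2 - (1 + \<beta>) * sigma_min ?W) * expectation (\<lambda>\<omega>. (norm (?u \<omega>))\<^sup>2)
      + (\<beta> + 2 * \<beta>\<^sup>2 + \<beta> * sigma_max ?W) * expectation (\<lambda>\<omega>. (norm (?v \<omega>))\<^sup>2)"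
    by (simp add: int)
  finally show "expectation (\<lambda>\<omega>. (norm (E (Suc (Suc t)) \<omega>))\<^sup>2) \<le> \<dots>" .
qed

section \<open>The convergence rate\<close>

theorem theorem1:
  fixes xstar x0 :: "real ^ 'n"
    and D :: "(real ^ 'n) measure"
    and M :: "'w measure"
    and \<phi> :: "nat \<Rightarrow> 'w \<Rightarrow> real ^ 'n"
    and y :: "nat \<Rightarrow> 'w \<Rightarrow> real"
    and x :: "nat \<Rightarrow> 'w \<Rightarrow> real ^ 'n"
    and \<beta> :: real
  assumes D_prob: "prob_space D"
    and D_sets: "sets D = sets borel"
    and D_nonzero: "AE v in D. v \<noteq> 0"
    and M_prob: "prob_space M"
    and \<phi>_indep: "prob_space.indep_vars M (\<lambda>_. borel) \<phi> {1..}"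
    and \<phi>_distr: "\<And>t. t \<ge> 1 \<Longrightarrow> distr M borel (\<phi> t) = D"
    and y_eq: "\<And>t \<omega>. t \<ge> 1 \<Longrightarrow> \<omega> \<in> space M \<Longrightarrow> y t \<omega> = \<phi> t \<omega> \<bullet> xstar"
    and \<beta>_bounds: "0 < \<beta>" "\<beta> < 1"
    and \<beta>_cond: "4 * \<beta> + 4 * \<beta>\<^sup>2 - (1 + \<beta>) * sigma_min (kaczmarz_matrix D)
                   + \<beta> * sigma_max (kaczmarz_matrix D) < 0"
    and x_iter: "\<And>t \<omega>. \<omega> \<in> space M \<Longrightarrow>
                   x t \<omega> = ohbk \<beta> (\<lambda>s. \<phi> s \<omega>) (\<lambda>s. y s \<omega>) x0 t"
  shows "\<exists>\<delta> q. \<delta> > 0 \<and> 0 < q \<and> q < 1 \<and>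
           (\<forall>t. integrable M (\<lambda>\<omega>. (norm (x t \<omega> - xstar))\<^sup>2) \<and>
                prob_space.expectation M (\<lambda>\<omega>. (norm (x t \<omega> - xstar))\<^sup>2)
                  \<le> q ^ t * (1 + \<delta>) * (norm (x0 - xstar))\<^sup>2)"
proof -
  interpret prob_space M by (rule M_prob)
  let ?W = "kaczmarz_matrix D"
  define e where "e = x0 - xstar"
  define E where "E t \<omega> = ohbk \<beta> (\<lambda>s. \<phi> s \<omega>) (\<lambda>_. 0) e t" for t \<omega>
  define F where "F t = expectation (\<lambda>\<omega>. (norm (E t \<omega>))\<^sup>2)" for t
  define a where "a = 1 + 3 * \<beta> + 2 * \<beta>\<^sup>2 - (1 + \<beta>) * sigma_min ?W"
  define b where "b = \<beta> + 2 * \<beta>\<^sup>2 + \<beta> * sigma_max ?W"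
  define q where "q = sqrt (a + b)"
  \<comment> \<open>Holds on the sample space only, which is all that the integrals see.\<close>
  have xE: "x t \<omega> - xstar = E t \<omega>" if "\<omega> \<in> space M" for t \<omega>
    unfolding x_iter[OF that] E_def e_def using y_eq that by (intro ohbk_diff_solution) auto
  have sym: "transpose ?W = ?W" and psd: "\<And>u. 0 \<le> (?W *v u) \<bullet> u"
    using transpose_kaczmarz_matrix kaczmarz_matrix_psd D_prob D_sets by blast+
  \<comment> \<open>Test both bounds on a unit vector; the coordinate \<open>undefined\<close> is an
    arbitrary choice.\<close>
  have "sigma_min ?W \<le> 1"
    using sigma_min_le_rayleigh[OF sym psd, of "axis undefined 1"]
      kaczmarz_matrix_le_norm[OF D_prob D_sets, of "axis undefined 1"] by simp
  then have "(1 + \<beta>) * sigma_min ?W \<le> 1 + \<beta>"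
    using \<beta>_bounds by (simp add: mult_left_le)
  \<comment> \<open>In fact \<open>a\<close> is at least
    \<open>2 * \<beta> + 2 * \<beta>\<^sup>2\<close>. Strict positivity makes \<open>q\<close>
    positive, so that \<open>1 / q\<close> is meaningful.\<close>
  then have a: "0 < a"
    using \<beta>_bounds unfolding a_def by (smt (verit) zero_le_power2)
  have "0 \<le> sigma_max ?W"
    using rayleigh_le_sigma_max[OF sym psd, of "axis undefined 1"] psd[of "axis undefined 1"] by simp
  then have b: "0 \<le> b" using \<beta>_bounds by (simp add: b_def)
  have "a + b < 1" using \<beta>_cond by (simp add: a_def b_def)
  then have q: "0 < q" "q < 1" "q\<^sup>2 = a + b" using a b by (auto simp: q_def)
  have F01: "F 0 = (norm e)\<^sup>2" "F 1 = F 0" by (simp_all add: F_def E_def prob_space)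
  note step = expectation_ohbk_step[OF D_prob D_sets \<phi>_indep \<phi>_distr, of \<beta> e]
  have int: "integrable M (\<lambda>\<omega>. (norm (E t \<omega>))\<^sup>2)" for t
    using step(1) \<beta>_bounds by (simp add: E_def)
  have rec: "F (Suc (Suc t)) \<le> a * F (Suc t) + b * F t" for t
    using step(2) \<beta>_bounds by (simp add: F_def E_def a_def b_def)
  have bound: "F t \<le> q ^ t * (F 0 / q)" for t
    using a b q F01 by (intro two_step_recursion_bound[where F = F and a = a and b = b] rec) auto
  have "integrable M (\<lambda>\<omega>. (norm (x t \<omega> - xstar))\<^sup>2)
      \<and> expectation (\<lambda>\<omega>. (norm (x t \<omega> - xstar))\<^sup>2) \<le> q ^ t * (1 + (1 / q - 1)) * (norm (x0 - xstar))\<^sup>2" for t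
  proof -
    have "integrable M (\<lambda>\<omega>. (norm (x t \<omega> - xstar))\<^sup>2)"
      using int[of t] by (subst Bochner_Integration.integrable_cong[OF refl]) (auto simp: xE)
    moreover have "expectation (\<lambda>\<omega>. (norm (x t \<omega> - xstar))\<^sup>2) = F t"
      unfolding F_def by (intro Bochner_Integration.integral_cong) (auto simp: xE)
    ultimately show ?thesis using bound[of t] F01 by (simp add: e_def)
  qed
  then show ?thesis using q by (intro exI[of _ "1 / q - 1"] exI[of _ q]) auto
qed

end
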